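(* Let $h\ge0$ be an integer, $H=h+1$, and let $z_1,\dots,z_h,z_{h+1}=a$ be nonnegative real numbers with $z_1+\cdots+z_h+a=1$. Let $P$ and $\tilde P$ be the transition matrices of the annihilation model on $\mathrm{St}_h$ and of the enriched annihilation model on $\mathcal{S}(H)$, and let $\Pi$ and $\tilde\Pi$ be their respective stationary distributions. For any initial probability distributions $\eta$ over $\mathrm{St}_h$ and $\tilde\eta$ over $\mathcal{S}(H)$ (viewed as row vectors), the distribution at time $h$ is equal to the stationary distribution, namely $$\eta P^h=\Pi,\qquad \tilde\eta\tilde P^h=\tilde\Pi.$$ In particular, the only eigenvalues of $P$ and $\tilde P$ are $1$ (with multiplicity $1$) and $0$.
   Context: $\mathrm{St}_h$ is the set of words of length $h$ on $\{\bullet,\circ\}$. $\mathcal{S}(n)$ is the set of all set partitions of $\{1,\dots,n\}$. For a word $A$ and an integer $i\ge0$, $S_i(A)$ is obtained by replacing by $\bullet$ the $i$-th occurrence of $\circ$ in $A$ when $A$ is read from the right; if $i=0$ or $i$ exceeds the number of $\circ$'s in $A$, then $S_i(A)=A$. For $\sigma\in\mathcal{S}(H)$, $\sigma^\downarrow\in\mathcal{S}(h)$ is obtained by removing $1$ from its block (and removing this block if it becomes empty), and shifting all remaining elements down by $1$. For $\tau\in\mathcal{S}(n)$ and an integer $i\ge0$, $J_i(\tau)\in\mathcal{S}(n+1)$ is obtained by inserting $n+1$ into the $i$-th block of $\tau$, the blocks being numbered by decreasing order of their maxima; if $i=0$ or $i$ exceeds the number of blocks of $\tau$, then $J_i(\tau)=\tau\cup\{\{n+1\}\}$.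 The annihilation model is the Markov chain on $\mathrm{St}_h$ whose transition probability from $A=a_1\cdots a_h$ to $B$ is $$P_{A,B}=\begin{cases}z_i&\text{if }B=S_i(a_2\cdots a_h\circ)\text{ for some }i\in\{1,\dots,k\},\\ z_{k+1}+\cdots+z_h+a&\text{if }B=a_2\cdots a_h\circ,\\0&\text{otherwise,}\end{cases}$$ with $k$ the number of $\circ$'s in $a_2\cdots a_h\circ$ (for $h=0$ the only state is the empty word and the chain stays there). The enriched annihilation model is the Markov chain on $\mathcal{S}(H)$ whose transition probability from $\sigma$ to $\tau$ is $$\tilde P_{\sigma,\tau}=\begin{cases}z_i&\text{if }\tau=J_i(\sigma^\downarrow)\text{ for some }i\in\{1,\dots,k\},\\ z_{k+1}+\cdots+z_h+a&\text{if }\tau=\sigma^\downarrow\cup\{\{H\}\},\\0&\text{otherwise,}\end{cases}$$ with $k$ the number of blocks of $\sigma^\downarrow$. (Here $z_{k+1}+\cdots+z_h+a$ means $\sum_{m=k+1}^{h+1}z_m$.) *)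

theory Defs
  imports "HOL-Library.Disjoint_Sets" "Jordan_Normal_Form.Spectral_Radius"
begin

datatype site = Bullet | Circ

definition St :: "nat \<Rightarrow> site list set" where
  "St h = {A. length A = h}"

definition set_partitions :: "nat \<Rightarrow> nat set set set" where
  "set_partitions n = {\<sigma>. partition_on {1..n} \<sigma>}"

text \<open>The occurrence of \<open>Circ\<close> at position \<open>p\<close> is the \<open>i\<close>-th one from the right iff exactly
  \<open>i\<close> occurrences lie at positions \<open>\<ge> p\<close>; for \<open>i = 0\<close> or \<open>i\<close> too large there is no such \<open>p\<close>,
  and the word is unchanged.\<close>

definition S_op :: "nat \<Rightarrow> site list \<Rightarrow> site list" where
  "S_op i A = map (\<lambda>p. if A ! p = Circ \<and> card {q. p \<le> q \<and> q < length A \<and> A ! q = Circ} = i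
                       then Bullet else A ! p) [0..<length A]"

definition down :: "nat set set \<Rightarrow> nat set set" where
  "down \<sigma> = (\<lambda>B. (\<lambda>x. x - 1) ` (B - {1})) ` \<sigma> - {{}}"

definition ith_block :: "nat \<Rightarrow> nat set set \<Rightarrow> nat set" where
  "ith_block i \<tau> = (THE B. B \<in> \<tau> \<and> card {C \<in> \<tau>. Max B \<le> Max C} = i)"

definition J_op :: "nat \<Rightarrow> nat \<Rightarrow> nat set set \<Rightarrow> nat set set" where
  "J_op n i \<tau> =
     (if i \<in> {1..card \<tau>}
      then insert (insert (n + 1) (ith_block i \<tau>)) (\<tau> - {ith_block i \<tau>})
      else \<tau> \<union> {{n + 1}})"

text \<open>In both transition functions the parameter \<open>a\<close> is \<open>z (h + 1)\<close>. The index \<open>i\<close> selected by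
  \<open>THE\<close> is unique, because different \<open>i \<in> {1..k}\<close> change different letters (respectively
  enlarge different blocks).\<close>

definition annihilation_prob ::
  "nat \<Rightarrow> (nat \<Rightarrow> real) \<Rightarrow> site list \<Rightarrow> site list \<Rightarrow> real" where
  "annihilation_prob h z A B =
     (if h = 0 then (if B = A then 1 else 0)
      else let C = tl A @ [Circ]; k = count_list C Circ in
        if \<exists>i\<in>{1..k}. B = S_op i C then z (THE i. i \<in> {1..k} \<and> B = S_op i C)
        else if B = C then (\<Sum>m = k + 1..h + 1. z m)
        else 0)"

text \<open>The states are partitions of \<open>{1..h + 1}\<close>, so \<open>down \<sigma>\<close> is a partition of \<open>{1..h}\<close>.\<close>

definition enriched_prob ::
  "nat \<Rightarrow> (nat \<Rightarrow> real) \<Rightarrow> nat set set \<Rightarrow> nat set set \<Rightarrow> real" where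
  "enriched_prob h z \<sigma> \<tau> =
     (let \<rho> = down \<sigma>; k = card \<rho> in
        if \<exists>i\<in>{1..k}. \<tau> = J_op h i \<rho> then z (THE i. i \<in> {1..k} \<and> \<tau> = J_op h i \<rho>)
        else if \<tau> = \<rho> \<union> {{h + 1}} then (\<Sum>m = k + 1..h + 1. z m)
        else 0)"

text \<open>Matrices are indexed by natural numbers, so the finite state space \<open>X\<close> comes with an
  enumeration \<open>e\<close>: index \<open>i < card X\<close> stands for the state \<open>e i\<close>.\<close>

definition transition_mat :: "'s set \<Rightarrow> (nat \<Rightarrow> 's) \<Rightarrow> ('s \<Rightarrow> 's \<Rightarrow> real) \<Rightarrow> real mat" where
  "transition_mat X e p = mat (card X) (card X) (\<lambda>(i, j). p (e i) (e j))"

definition prob_vec :: "nat \<Rightarrow> real vec \<Rightarrow> bool" where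
  "prob_vec N v \<longleftrightarrow> v \<in> carrier_vec N \<and> (\<forall>i<N. 0 \<le> v $ i) \<and> (\<Sum>i<N. v $ i) = 1"

definition stationary :: "real mat \<Rightarrow> real vec \<Rightarrow> bool" where
  "stationary P v \<longleftrightarrow> prob_vec (dim_row P) v \<and> mat_of_row v * P = mat_of_row v"

end

theory Submission
  imports Defs
begin

text \<open>Both chains are driven by independent moves \<open>i\<close> of law \<open>z\<close>, each acting as a map on states.
  After \<open>t\<close> moves, the last \<open>t\<close> letters of the word (respectively, the restriction of the partition to
  its \<open>t + 1\<close> largest elements) depend on the moves only, not on the initial state: an index \<open>i\<close>
  pointing beyond the recent part always has the same effect on it. Hence after \<open>h\<close> moves the whole state is
  independent of the start, so all rows of the \<open>h\<close>-th power of the transition matrix \<open>P\<close> equal the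
  stationary law. An eigenvector for a nonzero eigenvalue is then constant, so the eigenvalue is \<open>1\<close>,
  and the multiplicity of \<open>1\<close> is the trace of a matrix whose rows all equal a probability vector.\<close>

subsection \<open>Traces of matrix powers\<close>

lemma mult_mat_index:
  fixes A B :: "'a :: semiring_0 mat"
  assumes "A \<in> carrier_mat m k" "B \<in> carrier_mat k n" "i < m" "j < n"
  shows "(A * B) $$ (i, j) = (\<Sum>l<k. A $$ (i, l) * B $$ (l, j))"
  using assms by (auto simp: scalar_prod_def lessThan_atLeast0 intro!: sum.cong)

lemma sum_diag_mult_comm:
  fixes A B :: "'a :: comm_semiring_1 mat"
  assumes "A \<in> carrier_mat n m" "B \<in> carrier_mat m n"
  shows "(\<Sum>i<n. (A * B) $$ (i, i)) = (\<Sum>i<m. (B * A) $$ (i, i))"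
proof -
  have "(\<Sum>i<n. (A * B) $$ (i, i)) = (\<Sum>i<n. \<Sum>j<m. A $$ (i, j) * B $$ (j, i))"
    using assms by (auto simp: scalar_prod_def lessThan_atLeast0 intro!: sum.cong)
  also have "\<dots> = (\<Sum>j<m. \<Sum>i<n. B $$ (j, i) * A $$ (i, j))"
    by (subst sum.swap) (simp add: mult.commute)
  also have "\<dots> = (\<Sum>i<m. (B * A) $$ (i, i))"
    using assms by (auto simp: scalar_prod_def lessThan_atLeast0 intro!: sum.cong)
  finally show ?thesis .
qed

text \<open>In the product sum over \<open>k\<close>, the terms with \<open>k < i\<close> vanish
  through the left factor and those with \<open>k > j\<close> through the right one. Nothing is left
  below the diagonal, and only \<open>k = i\<close> on it.\<close>

lemma upper_triangular_pow:
  fixes B :: "'a :: comm_semiring_1 mat"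
  assumes B: "B \<in> carrier_mat n n" and ut: "upper_triangular B"
  shows "upper_triangular (B ^\<^sub>m m) \<and> (\<forall>i<n. (B ^\<^sub>m m) $$ (i, i) = B $$ (i, i) ^ m)"
proof (induction m)
  case 0
  then show ?case using B by (auto simp: upper_triangular_def)
next
  case (Suc m)
  let ?C = "B ^\<^sub>m m"
  have C: "?C \<in> carrier_mat n n" using B by simp
  have entry: "(?C * B) $$ (i, j) = (\<Sum>k<n. ?C $$ (i, k) * B $$ (k, j))" if "i < n" "j < n" for i j
    by (rule mult_mat_index[OF C B that])
  have C0: "?C $$ (i, k) = 0" if "k < i" "i < n" for i k
    using Suc that C by (auto simp: upper_triangular_def)
  have B0: "B $$ (i, k) = 0" if "k < i" "i < n" for i k
    using ut that B by (auto simp: upper_triangular_def)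
  have "(?C * B) $$ (i, j) = 0" if "j < i" "i < n" for i j
  proof -
    have "?C $$ (i, k) * B $$ (k, j) = 0" if "k < n" for k
      using C0[of k i] B0[of j k] \<open>j < i\<close> \<open>i < n\<close> that by (cases "k < i") auto
    then show ?thesis using that by (simp add: entry)
  qed
  moreover have "(?C * B) $$ (i, i) = B $$ (i, i) ^ Suc m" if i: "i < n" for i
  proof -
    have "?C $$ (i, k) * B $$ (k, i) = (if k = i then B $$ (i, i) ^ Suc m else 0)" if "k < n" for k
      using C0[of k i] B0[of i k] Suc i that by (cases k i rule: linorder_cases) (auto simp: mult.commute)
    then have "(?C * B) $$ (i, i) = (\<Sum>k<n. if k = i then B $$ (i, i) ^ Suc m else 0)"
      using i by (simp add: entry)
    also have "\<dots> = B $$ (i, i) ^ Suc m" using i by simp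
    finally show ?thesis .
  qed
  ultimately show ?case using B by (auto simp: upper_triangular_def)
qed

text \<open>A Schur decomposition conjugates \<open>A\<close> to a triangular matrix with diagonal
  \<open>as\<close>. The trace of a power is invariant under this conjugation, and for the
  triangular matrix it is read off the diagonal.\<close>

lemma sum_diag_pow_eq_power_sum:
  fixes A :: "complex mat"
  assumes A: "A \<in> carrier_mat n n" and cp: "char_poly A = (\<Prod>a\<leftarrow>as. [:- a, 1:])"
  shows "(\<Sum>i<n. (A ^\<^sub>m m) $$ (i, i)) = (\<Sum>a\<leftarrow>as. a ^ m)"
proof -
  obtain B R Q where dec: "schur_decomposition A as = (B, R, Q)"
    by (cases "schur_decomposition A as") auto
  from schur_decomposition[OF A cp dec] have wit: "similar_mat_wit A B R Q"
    and ut: "upper_triangular B" and diag: "diag_mat B = as" by auto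
  from similar_mat_witD2[OF A wit] have B: "B \<in> carrier_mat n n" and R: "R \<in> carrier_mat n n"
    and Q: "Q \<in> carrier_mat n n" and QR: "Q * R = 1\<^sub>m n" by auto
  have "(\<Sum>i<n. (A ^\<^sub>m m) $$ (i, i)) = (\<Sum>i<n. ((R * B ^\<^sub>m m) * Q) $$ (i, i))"
    by (simp add: similar_mat_wit_pow_id[OF wit])
  also have "\<dots> = (\<Sum>i<n. (Q * (R * B ^\<^sub>m m)) $$ (i, i))"
    by (rule sum_diag_mult_comm) (use B R Q in auto)
  also have "Q * (R * B ^\<^sub>m m) = B ^\<^sub>m m"
    using B R Q QR assoc_mult_mat[of Q n n R n "B ^\<^sub>m m" n] by simp
  also have "(\<Sum>i<n. (B ^\<^sub>m m) $$ (i, i)) = (\<Sum>i<n. B $$ (i, i) ^ m)"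
    using upper_triangular_pow[OF B ut] by simp
  also have "\<dots> = (\<Sum>a\<leftarrow>as. a ^ m)"
    using B unfolding diag[symmetric] diag_mat_def
    by (simp add: sum_list_sum_nth lessThan_atLeast0)
  finally show ?thesis .
qed

text \<open>Root orders add over products, and each linear factor contributes only at its own root.
  This turns algebraic multiplicity into a count in the list of eigenvalues.\<close>

lemma order_prod_list_linear:
  fixes as :: "'a :: idom list"
  shows "order b (\<Prod>a\<leftarrow>as. [:- a, 1:]) = count_list as b"
proof (induction as)
  case (Cons a as)
  have nz: "(\<Prod>a\<leftarrow>as. [:- a, 1:]) \<noteq> 0"
    by (auto simp: prod_list_zero_iff)
  have "order b [:- a, 1:] = (if a = b then 1 else 0)"
    using order_power_n_n[of b 1] by (auto intro: order_0I)
  moreover have "[:- a, 1:] * (\<Prod>a\<leftarrow>as. [:- a, 1:]) \<noteq> 0"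
    using nz by (simp only: mult_eq_0_iff) simp
  ultimately show ?case
    unfolding list.map prod_list.Cons by (subst order_mult) (use Cons in simp_all)
qed simp

subsection \<open>Stochastic matrices with a power of equal rows\<close>

definition ones :: "nat \<Rightarrow> 'a :: one vec" where
  "ones n = vec n (\<lambda>_. 1)"

lemma ones_carrier [simp]: "ones n \<in> carrier_vec n"
  by (simp add: ones_def)

lemma mult_ones_index:
  fixes A :: "'a :: semiring_1 mat"
  assumes "A \<in> carrier_mat m n" "i < m"
  shows "(A *\<^sub>v ones n) $ i = (\<Sum>j<n. A $$ (i, j))"
  using assms by (auto simp: ones_def scalar_prod_def lessThan_atLeast0)

text \<open>The row sums are encoded as a fixed vector of \<open>A\<close>, so that the condition
  passes to powers by associativity.\<close>

definition stochastic_mat :: "nat \<Rightarrow> real mat \<Rightarrow> bool" where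
  "stochastic_mat n A \<longleftrightarrow>
     A \<in> carrier_mat n n \<and> (\<forall>i<n. \<forall>j<n. 0 \<le> A $$ (i, j)) \<and> A *\<^sub>v ones n = ones n"

lemma stochastic_mat_pow:
  assumes "stochastic_mat n A"
  shows "stochastic_mat n (A ^\<^sub>m m)"
proof (induction m)
  case 0
  then show ?case using assms by (auto simp: stochastic_mat_def)
next
  case (Suc m)
  have A: "A \<in> carrier_mat n n" and Am: "A ^\<^sub>m m \<in> carrier_mat n n"
    using assms by (auto simp: stochastic_mat_def)
  have car: "A ^\<^sub>m m * A \<in> carrier_mat n n" using mult_carrier_mat[OF Am A] .
  have "0 \<le> (A ^\<^sub>m m * A) $$ (i, j)" if "i < n" "j < n" for i j
  proof -
    have "(A ^\<^sub>m m * A) $$ (i, j) = (\<Sum>k<n. (A ^\<^sub>m m) $$ (i, k) * A $$ (k, j))"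
      by (rule mult_mat_index[OF Am A that])
    also have "\<dots> \<ge> 0"
      using Suc assms that by (intro sum_nonneg) (auto simp: stochastic_mat_def)
    finally show ?thesis .
  qed
  moreover have "(A ^\<^sub>m m * A) *\<^sub>v ones n = ones n"
    using assms Suc A Am by (simp add: stochastic_mat_def assoc_mult_mat_vec[of _ n n _ n])
  ultimately show ?case using car unfolding stochastic_mat_def pow_mat.simps by blast
qed

lemma mat_of_row_inject:
  assumes "mat_of_row v = mat_of_row w"
  shows "v = w"
proof (rule eq_vecI)
  show d: "dim_vec v = dim_vec w" using arg_cong[OF assms, of dim_col] by simp
  show "v $ i = w $ i" if "i < dim_vec w" for i
    using that d arg_cong[OF assms, of "\<lambda>M. M $$ (0, i)"] by simp
qed

text \<open>Needed because \<open>pow_mat\<close> adds factors on the right, while several arguments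
  below peel a factor off on the left.\<close>

lemma commute_pow_mat:
  fixes A :: "'a :: semiring_1 mat"
  assumes A: "A \<in> carrier_mat n n"
  shows "A * A ^\<^sub>m m = A ^\<^sub>m m * A"
proof (induction m)
  case (Suc m)
  have "A * A ^\<^sub>m Suc m = (A * A ^\<^sub>m m) * A"
    using A by (simp add: assoc_mult_mat[of _ n n _ n _ n])
  then show ?case using Suc by simp
qed (use A in simp)

text \<open>The interface between probability and linear algebra: stationarity, convergence and the
  spectrum are all derived from these assumptions, and both models are interpretations. Row
  \<open>0\<close> serves as the representative row.\<close>

locale equal_rows_power =
  fixes n h :: nat and P :: "real mat"
  assumes n_pos: "0 < n"
    and stoch: "stochastic_mat n P"
    and equal_rows: "\<And>i j. i < n \<Longrightarrow> j < n \<Longrightarrow> (P ^\<^sub>m h) $$ (i, j) = (P ^\<^sub>m h) $$ (0, j)"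
begin

lemma carrier [simp]: "P \<in> carrier_mat n n"
  using stoch by (simp add: stochastic_mat_def)

lemma dim [simp]: "dim_row P = n" "dim_col P = n"
  using carrier by (auto simp del: carrier)

lemma pow_carrier [simp]: "P ^\<^sub>m m \<in> carrier_mat n n"
  by (simp add: pow_carrier_mat)

definition limit_row :: "real vec" where
  "limit_row = row (P ^\<^sub>m h) 0"

lemma dim_pow [simp]: "dim_row (P ^\<^sub>m m) = n" "dim_col (P ^\<^sub>m m) = n"
  by (simp_all add: pow_mat_dim_square[OF carrier])

lemma limit_row_carrier [simp]: "limit_row \<in> carrier_vec n"
  unfolding limit_row_def carrier_vec_def by simp

lemma dim_limit_row [simp]: "dim_vec limit_row = n"
  using limit_row_carrier by (simp del: limit_row_carrier)

lemma pow_index: "i < n \<Longrightarrow> j < n \<Longrightarrow> (P ^\<^sub>m h) $$ (i, j) = limit_row $ j"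
  using n_pos equal_rows[of i j] by (simp add: limit_row_def)

lemma prob_vec_limit_row: "prob_vec n limit_row"
proof -
  note st = stochastic_mat_pow[OF stoch, of h]
  have "(\<Sum>j<n. limit_row $ j) = (P ^\<^sub>m h *\<^sub>v ones n) $ 0"
    using mult_ones_index[OF pow_carrier n_pos, of h] pow_index n_pos by simp
  also have "\<dots> = 1"
    using st n_pos by (simp add: stochastic_mat_def ones_def)
  finally show ?thesis
    using st n_pos pow_index[of 0] by (auto simp: prob_vec_def stochastic_mat_def)
qed

text \<open>Since all rows of the power equal \<open>limit_row\<close>, multiplication by
  \<open>\<eta>\<close> on the left only scales that row by the total mass of \<open>\<eta>\<close>,
  which is 1.\<close>

lemma prob_vec_mult_pow:
  assumes "prob_vec n \<eta>"
  shows "mat_of_row \<eta> * P ^\<^sub>m h = mat_of_row limit_row"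
proof (rule eq_matI)
  have \<eta>: "\<eta> \<in> carrier_vec n" "(\<Sum>i<n. \<eta> $ i) = 1" using assms by (auto simp: prob_vec_def)
  fix i j assume "i < dim_row (mat_of_row limit_row)" "j < dim_col (mat_of_row limit_row)"
  then have i: "i = 0" and j: "j < n" using limit_row_carrier by auto
  have "(mat_of_row \<eta> * P ^\<^sub>m h) $$ (0, j) = (\<Sum>k<n. \<eta> $ k * (P ^\<^sub>m h) $$ (k, j))"
    using mult_mat_index[OF mat_of_row_carrier(1)[OF \<eta>(1)] pow_carrier _ j, of 0 h] \<eta>(1) by simp
  also have "\<dots> = (\<Sum>k<n. \<eta> $ k) * limit_row $ j"
    by (simp add: pow_index j sum_distrib_right)
  finally show "(mat_of_row \<eta> * P ^\<^sub>m h) $$ (i, j) = mat_of_row limit_row $$ (i, j)"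
    using \<eta> i j limit_row_carrier by auto
qed (use assms limit_row_carrier pow_carrier[of h] in \<open>auto simp: prob_vec_def\<close>)

lemma stationary_limit_row: "stationary P limit_row"
proof -
  have row: "mat_of_row limit_row \<in> carrier_mat 1 n"
    using limit_row_carrier by (auto intro: mat_of_row_carrier)
  have sum1: "(\<Sum>k<n. P $$ (i, k)) = 1" if "i < n" for i
    using that stoch mult_ones_index[OF carrier that] by (simp add: stochastic_mat_def ones_def)
  have "(P * P ^\<^sub>m h) $$ (i, j) = limit_row $ j" if "i < n" "j < n" for i j
  proof -
    have "(P * P ^\<^sub>m h) $$ (i, j) = (\<Sum>k<n. P $$ (i, k) * (P ^\<^sub>m h) $$ (k, j))"
      by (rule mult_mat_index[OF carrier pow_carrier that])
    also have "\<dots> = (\<Sum>k<n. P $$ (i, k)) * limit_row $ j"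
      by (simp add: pow_index that sum_distrib_right)
    finally show ?thesis using sum1[OF that(1)] by simp
  qed
  \<comment> \<open>Averaging equal rows with weights of sum 1 gives the same row back.\<close>
  then have absorb: "P * P ^\<^sub>m h = P ^\<^sub>m h"
    using pow_index by (intro eq_matI) (simp_all only: index_mult_mat(2,3) dim dim_pow)
  \<comment> \<open>The \<open>h\<close>-th power fixes \<open>limit_row\<close>, so it can be
    inserted; \<open>P\<close> is then moved to its left and absorbed.\<close>
  have "mat_of_row limit_row * P = mat_of_row limit_row * P ^\<^sub>m h * P"
    by (simp only: prob_vec_mult_pow[OF prob_vec_limit_row])
  also have "\<dots> = mat_of_row limit_row * (P ^\<^sub>m h * P)"
    by (rule assoc_mult_mat[OF row]) auto
  also have "\<dots> = mat_of_row limit_row"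
    by (simp only: commute_pow_mat[OF carrier, symmetric] absorb prob_vec_mult_pow[OF prob_vec_limit_row])
  finally show ?thesis
    using prob_vec_limit_row carrier unfolding stationary_def by auto
qed

text \<open>A stationary law is fixed by every power of \<open>P\<close>, but the
  \<open>h\<close>-th power sends every probability vector to \<open>limit_row\<close>.\<close>

lemma stationary_unique:
  assumes "stationary P \<pi>"
  shows "\<pi> = limit_row"
proof -
  have pv: "prob_vec n \<pi>" and inv: "mat_of_row \<pi> * P = mat_of_row \<pi>"
    using assms carrier by (auto simp: stationary_def)
  have row: "mat_of_row \<pi> \<in> carrier_mat 1 n"
    using pv by (auto simp: prob_vec_def)
  have "mat_of_row \<pi> * P ^\<^sub>m m = mat_of_row \<pi>" for m
  proof (induction m)
    case 0
    show ?case using row carrier by (auto simp del: carrier)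
  next
    case (Suc m)
    have "mat_of_row \<pi> * P ^\<^sub>m Suc m = (mat_of_row \<pi> * P ^\<^sub>m m) * P"
      by (simp add: assoc_mult_mat[OF row pow_carrier carrier])
    then show ?case by (simp add: Suc inv)
  qed
  from this[of h] show ?thesis
    using prob_vec_mult_pow[OF pv] by (intro mat_of_row_inject) simp
qed

section \<open>The spectrum over the complex numbers, where the characteristic polynomial
  splits\<close>

abbreviation cP :: "complex mat" where
  "cP \<equiv> map_mat complex_of_real P"

lemma cP_carrier: "cP \<in> carrier_mat n n"
  by simp

lemma cP_pow: "cP ^\<^sub>m m = map_mat complex_of_real (P ^\<^sub>m m)"
  by (rule of_real_hom.mat_hom_pow[OF carrier, symmetric])

lemma cP_ones: "cP *\<^sub>v ones n = ones n"
proof (rule eq_vecI)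
  fix i assume "i < dim_vec (ones n :: complex vec)"
  then have i: "i < n" by (simp add: ones_def)
  have *: "(cP *\<^sub>v ones n) $ i = complex_of_real ((P *\<^sub>v ones n) $ i)"
    unfolding mult_ones_index[OF cP_carrier i] mult_ones_index[OF carrier i]
    using i by simp
  then show "(cP *\<^sub>v ones n) $ i = ones n $ i"
    using stoch i unfolding * stochastic_mat_def by (simp add: ones_def)
qed (simp add: ones_def)

lemma eigenvalue_cP_cases:
  assumes "eigenvalue cP \<mu>"
  shows "\<mu> = 0 \<or> \<mu> = 1"
proof (rule disjCI)
  assume "\<mu> \<noteq> 1"
  obtain v where v: "eigenvector cP v \<mu>" using assms by (auto simp: eigenvalue_def)
  then have vc: "v \<in> carrier_vec n" and v0: "v \<noteq> 0\<^sub>v n" and Pv: "cP *\<^sub>v v = \<mu> \<cdot>\<^sub>v v"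
    using carrier by (auto simp: eigenvector_def)
  \<comment> \<open>All rows of the \<open>h\<close>-th power are \<open>limit_row\<close>, so
    \<open>c\<close> is the value of every entry of that power applied to \<open>v\<close>.\<close>
  define c where "c = (\<Sum>j<n. complex_of_real (limit_row $ j) * v $ j)"
  have "cP ^\<^sub>m h *\<^sub>v v = c \<cdot>\<^sub>v ones n"
    unfolding cP_pow using vc
    by (intro eq_vecI) (auto simp: scalar_prod_def lessThan_atLeast0 c_def ones_def pow_index intro!: sum.cong)
  moreover have "cP ^\<^sub>m h *\<^sub>v v = \<mu> ^ h \<cdot>\<^sub>v v"
    by (rule eigenvector_pow[OF cP_carrier v])
  ultimately have eq: "\<mu> ^ h \<cdot>\<^sub>v v = c \<cdot>\<^sub>v ones n" by simp
  show "\<mu> = 0"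
  proof (rule ccontr)
    assume "\<mu> \<noteq> 0"
    \<comment> \<open>The power also scales \<open>v\<close> by \<open>\<mu> ^ h\<close>, which is
      nonzero here, so every entry of \<open>v\<close> equals \<open>d\<close>.\<close>
    define d where "d = c / \<mu> ^ h"
    have vd: "v = d \<cdot>\<^sub>v ones n"
    proof (rule eq_vecI)
      fix i assume "i < dim_vec (d \<cdot>\<^sub>v ones n)"
      then have "i < n" by (simp add: ones_def)
      then show "v $ i = (d \<cdot>\<^sub>v ones n) $ i"
        using arg_cong[OF eq, of "\<lambda>w. w $ i"] vc \<open>\<mu> \<noteq> 0\<close> by (auto simp: ones_def d_def field_simps)
    qed (use vc in \<open>simp add: ones_def\<close>)
    \<comment> \<open>Constant vectors are fixed, so \<open>v\<close> belongs to the eigenvalue 1 as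
      well as to \<open>\<mu>\<close>; since these differ, \<open>v\<close> is zero.\<close>
    have "cP *\<^sub>v v = v"
      unfolding vd using cP_ones mult_mat_vec[OF cP_carrier ones_carrier, of d] by simp
    then have "\<mu> * v $ i = v $ i" if "i < n" for i
      using arg_cong[OF Pv, of "\<lambda>w. w $ i"] that vc by auto
    then have "v $ i = 0" if "i < n" for i
      using that \<open>\<mu> \<noteq> 1\<close> by fastforce
    then have "v = 0\<^sub>v n" using vc by (intro eq_vecI) auto
    then show False using v0 by simp
  qed
qed

text \<open>Each row of \<open>P\<close> is itself a probability vector, so
  \<open>prob_vec_mult_pow\<close> applies to it.\<close>

lemma pow_Suc_index:
  assumes "i < n" "j < n"
  shows "(P ^\<^sub>m Suc h) $$ (i, j) = limit_row $ j"
proof -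
  have pv: "prob_vec n (row P i)"
    using stoch mult_ones_index[OF carrier assms(1)] assms carrier
    by (auto simp: prob_vec_def stochastic_mat_def ones_def)
  have "(P ^\<^sub>m Suc h) $$ (i, j) = (P * P ^\<^sub>m h) $$ (i, j)"
    by (simp add: commute_pow_mat[OF carrier])
  also have "\<dots> = (mat_of_row (row P i) * P ^\<^sub>m h) $$ (0, j)"
    using assms carrier pow_carrier[of h] by auto
  also have "\<dots> = limit_row $ j"
    using assms limit_row_carrier by (auto simp: prob_vec_mult_pow[OF pv])
  finally show ?thesis .
qed

text \<open>The trace of \<open>P ^ Suc h\<close>, whose rows all equal the limit row, is the number of
  eigenvalues \<open>1\<close>; the exponent \<open>Suc h\<close> instead of \<open>h\<close> avoids \<open>0 ^ 0 = 1\<close>.\<close>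

lemma char_poly_cP:
  "\<exists>as. char_poly cP = (\<Prod>a\<leftarrow>as. [:- a, 1:]) \<and> length as = n
    \<and> set as \<subseteq> {0, 1} \<and> count_list as 1 = 1"
proof -
  obtain as where cp: "char_poly cP = (\<Prod>a\<leftarrow>as. [:- a, 1:])" and len: "length as = n"
    using char_poly_factorized[OF cP_carrier] by auto
  have "eigenvalue cP a" if "a \<in> set as" for a
    unfolding eigenvalue_root_char_poly[OF cP_carrier] cp
    using that by (auto simp: poly_prod_list prod_list_zero_iff)
  then have as01: "set as \<subseteq> {0, 1}" using eigenvalue_cP_cases by blast
  \<comment> \<open>Each root is 0 or 1, so its positive power is the indicator of being 1.\<close>
  have "complex_of_nat (count_list as 1) = (\<Sum>a\<leftarrow>as. a ^ Suc h)"
    using as01 by (induction as) auto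
  also have "\<dots> = (\<Sum>i<n. (cP ^\<^sub>m Suc h) $$ (i, i))"
    by (rule sum_diag_pow_eq_power_sum[OF cP_carrier cp, symmetric])
  also have "\<dots> = (\<Sum>i<n. complex_of_real (limit_row $ i))"
    unfolding cP_pow
  proof (rule sum.cong)
    fix i assume "i \<in> {..<n}"
    then show "map_mat complex_of_real (P ^\<^sub>m Suc h) $$ (i, i) = complex_of_real (limit_row $ i)"
      using pow_Suc_index[of i i] by (simp del: pow_mat.simps)
  qed simp
  also have "\<dots> = of_real (\<Sum>i<n. limit_row $ i)" by simp
  also have "\<dots> = of_nat 1" using prob_vec_limit_row by (simp add: prob_vec_def)
  finally have "count_list as 1 = 1" using of_nat_eq_iff by blast
  with cp len as01 show ?thesis by blast
qed

lemma order_char_poly_cP: "order 1 (char_poly cP) = 1"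
proof -
  obtain as where "char_poly cP = (\<Prod>a\<leftarrow>as. [:- a, 1:])" "count_list as 1 = 1"
    using char_poly_cP by (elim exE conjE) (rule that)
  then show ?thesis by (simp only: order_prod_list_linear)
qed

text \<open>Of the \<open>n\<close> roots exactly one is 1 and all others are 0, so 0 occurs as soon
  as there is a second root.\<close>

lemma spectrum_cP: "spectrum cP = (if n = 1 then {1} else {0, 1})"
proof -
  obtain as where as: "char_poly cP = (\<Prod>a\<leftarrow>as. [:- a, 1:])" "length as = n"
    "set as \<subseteq> {0, 1}" "count_list as 1 = 1" using char_poly_cP by (elim exE conjE) (rule that)
  have "poly (char_poly cP) x = 0 \<longleftrightarrow> x \<in> set as" for x
    unfolding as(1) by (auto simp: poly_prod_list prod_list_zero_iff)
  then have sp: "spectrum cP = set as"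
    unfolding spectrum_root_char_poly[OF cP_carrier] by simp
  have 1: "1 \<in> set as" using as(4) count_notin[of 1 as] by auto
  show ?thesis
  proof (cases "n = 1")
    case True
    then obtain b where "as = [b]" using as(2) by (auto simp: length_Suc_conv)
    then show ?thesis using 1 sp True by auto
  next
    case False
    have "0 \<in> set as"
    proof (rule ccontr)
      assume "0 \<notin> set as"
      then have "set as \<subseteq> {1}" using as(3) by auto
      then have "count_list as 1 = length as" by (induction as) auto
      then show False using False as by simp
    qed
    then show ?thesis using 1 as(3) sp False by auto
  qed
qed

end

subsection \<open>Chains driven by random maps\<close>

text \<open>A coupling argument carried out on functions instead of laws. \<open>R t\<close>
  expresses the agreement of two states that \<open>t\<close> common moves enforce. Every function
  respects \<open>R h\<close>, only constant functions respect \<open>R 0\<close>, and one averaging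
  by \<open>P\<close> lowers the index by one, so \<open>h\<close> averagings make any function
  constant.\<close>

lemma random_map_power_equal_rows:
  fixes X :: "'s set" and f :: "'i \<Rightarrow> 's \<Rightarrow> 's" and z :: "'i \<Rightarrow> real"
    and R :: "nat \<Rightarrow> 's \<Rightarrow> 's \<Rightarrow> bool"
  assumes e: "bij_betw e {..<card X} X"
    and X: "finite X" "X \<noteq> {}" and I: "finite I"
    and z_nonneg: "\<And>i. i \<in> I \<Longrightarrow> 0 \<le> z i" and z_sum: "sum z I = 1"
    and closed: "\<And>i x. i \<in> I \<Longrightarrow> x \<in> X \<Longrightarrow> f i x \<in> X"
    and p: "\<And>x y. x \<in> X \<Longrightarrow> y \<in> X \<Longrightarrow> p x y = sum z {i \<in> I. f i x = y}"
    and R_0: "\<And>x y. x \<in> X \<Longrightarrow> y \<in> X \<Longrightarrow> R 0 x y"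
    and R_Suc: "\<And>t i x y. t < h \<Longrightarrow> i \<in> I \<Longrightarrow> x \<in> X \<Longrightarrow> y \<in> X \<Longrightarrow> R t x y
      \<Longrightarrow> R (Suc t) (f i x) (f i y)"
    and R_h: "\<And>x y. x \<in> X \<Longrightarrow> y \<in> X \<Longrightarrow> R h x y \<Longrightarrow> x = y"
  shows "equal_rows_power (card X) h (transition_mat X e p)"
proof -
  define n where "n = card X"
  define P where "P = transition_mat X e p"
  \<comment> \<open>\<open>w g\<close> lists the values of a function on states in the order of the
    enumeration; \<open>P\<close> acts on it by averaging over one move.\<close>
  define w where "w g = vec n (\<lambda>a. g (e a))" for g :: "'s \<Rightarrow> real"
  have P: "P \<in> carrier_mat n n" by (simp add: P_def n_def transition_mat_def)
  have eX: "e a \<in> X" if "a < n" for a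
    using bij_betwE[OF e] that by (simp add: n_def)
  have n_pos: "0 < n" using X by (simp add: n_def card_gt_0_iff)
  have step: "P *\<^sub>v w g = w (\<lambda>x. \<Sum>i\<in>I. z i * g (f i x))" for g
  proof (rule eq_vecI)
    fix a assume "a < dim_vec (w (\<lambda>x. \<Sum>i\<in>I. z i * g (f i x)))"
    then have a: "a < n" by (simp add: w_def)
    have "(P *\<^sub>v w g) $ a = (\<Sum>b<n. p (e a) (e b) * g (e b))"
      using a by (simp add: P_def transition_mat_def w_def n_def scalar_prod_def lessThan_atLeast0)
    also have "\<dots> = (\<Sum>y\<in>X. p (e a) y * g y)"
      using sum.reindex_bij_betw[OF e, of "\<lambda>y. p (e a) y * g y"] by (simp add: n_def)
    also have "\<dots> = (\<Sum>y\<in>X. \<Sum>i | i \<in> I \<and> f i (e a) = y. z i * g (f i (e a)))"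
      using p[OF eX[OF a]] by (auto simp: sum_distrib_right intro!: sum.cong)
    also have "\<dots> = (\<Sum>i\<in>I. z i * g (f i (e a)))"
      using closed eX[OF a] by (intro sum.group I X(1)) auto
    finally show "(P *\<^sub>v w g) $ a = w (\<lambda>x. \<Sum>i\<in>I. z i * g (f i x)) $ a"
      using a by (simp add: w_def)
  qed (use P in \<open>simp add: w_def\<close>)
  have w_ones: "w (\<lambda>_. 1) = ones n" by (simp add: w_def ones_def)
  have stoch: "stochastic_mat n P"
    unfolding stochastic_mat_def
  proof (intro conjI allI impI)
    fix a b assume "a < n" "b < n"
    then show "0 \<le> P $$ (a, b)"
      using p[of "e a" "e b"] eX z_nonneg
      by (auto simp: P_def transition_mat_def n_def intro!: sum_nonneg)
  qed (use P step[of "\<lambda>_. 1"] in \<open>simp_all add: w_ones z_sum\<close>)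
  have iter: "\<exists>g'. P ^\<^sub>m t *\<^sub>v w g = w g' \<and> (\<forall>x\<in>X. \<forall>y\<in>X. R (h - t) x y \<longrightarrow> g' x = g' y)"
    if "t \<le> h" for t g
    using that
  proof (induction t)
    case 0
    have "P ^\<^sub>m 0 *\<^sub>v w g = w g" using P by (simp add: w_def)
    then show ?case using R_h by auto
  next
    case (Suc t)
    then obtain g' where g': "P ^\<^sub>m t *\<^sub>v w g = w g'"
      and inv: "\<And>x y. x \<in> X \<Longrightarrow> y \<in> X \<Longrightarrow> R (h - t) x y \<Longrightarrow> g' x = g' y" by auto
    \<comment> \<open>The new factor is put on the left, where it averages the function
      \<open>g'\<close> obtained so far.\<close>
    have "P ^\<^sub>m Suc t *\<^sub>v w g = P *\<^sub>v (P ^\<^sub>m t *\<^sub>v w g)"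
      unfolding pow_mat.simps commute_pow_mat[OF P, symmetric]
      by (rule assoc_mult_mat_vec[OF P pow_carrier_mat[OF P]]) (simp add: w_def)
    also have "\<dots> = w (\<lambda>x. \<Sum>i\<in>I. z i * g' (f i x))" by (simp only: g' step)
    finally have "P ^\<^sub>m Suc t *\<^sub>v w g = w (\<lambda>x. \<Sum>i\<in>I. z i * g' (f i x))" .
    moreover have "(\<Sum>i\<in>I. z i * g' (f i x)) = (\<Sum>i\<in>I. z i * g' (f i y))"
      if xy: "x \<in> X" "y \<in> X" "R (h - Suc t) x y" for x y
    proof (rule sum.cong)
      fix i assume i: "i \<in> I"
      \<comment> \<open>As \<open>Suc t \<le> h\<close>, the index \<open>Suc (h - Suc t)\<close> is
        \<open>h - t\<close>, the one for which \<open>inv\<close> is available.\<close>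
      have "R (Suc (h - Suc t)) (f i x) (f i y)"
        using R_Suc[OF _ i xy] Suc.prems by simp
      then have "g' (f i x) = g' (f i y)"
        using Suc.prems by (intro inv closed i xy) (simp add: Suc_diff_Suc)
      then show "z i * g' (f i x) = z i * g' (f i y)" by simp
    qed simp
    ultimately show ?case by blast
  qed
  have "(P ^\<^sub>m h) $$ (a, b) = (P ^\<^sub>m h) $$ (0, b)" if ab: "a < n" "b < n" for a b
  proof -
    \<comment> \<open>The indicator of the state \<open>e b\<close> extracts column \<open>b\<close>
      of the power; constant columns mean equal rows.\<close>
    define g where "g y = (if y = e b then 1 else 0 :: real)" for y
    obtain g' where g': "P ^\<^sub>m h *\<^sub>v w g = w g'"
      and const: "\<And>x y. x \<in> X \<Longrightarrow> y \<in> X \<Longrightarrow> g' x = g' y"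
      using iter[OF order_refl, of g] R_0 unfolding diff_self_eq_0 by blast
    have "inj_on e {..<n}" using e by (simp add: n_def bij_betw_def)
    then have "w g = unit_vec n b"
      using ab by (auto simp: w_def g_def unit_vec_def inj_on_def)
    moreover have "P ^\<^sub>m h *\<^sub>v unit_vec n b = col (P ^\<^sub>m h) b"
      using pow_carrier_mat[OF P, of h] ab by (intro eq_vecI) auto
    ultimately have col: "col (P ^\<^sub>m h) b = w g'" using g' by simp
    have "(P ^\<^sub>m h) $$ (c, b) = g' (e c)" if "c < n" for c
      using arg_cong[OF col, of "\<lambda>v. v $ c"] that ab carrier_matD[OF pow_carrier_mat[OF P, of h]]
      by (simp add: w_def)
    then show ?thesis using const[OF eX[OF ab(1)] eX[OF n_pos]] ab n_pos by simp
  qed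
  then show ?thesis
    unfolding P_def[symmetric] n_def[symmetric]
    by (intro equal_rows_power.intro n_pos stoch)
qed

text \<open>This rewrites the case distinctions defining the transition probabilities as the law of
  a random map. The fibre over \<open>y\<close> is a single index at most \<open>k\<close>, the set
  of all indices beyond \<open>k\<close>, or empty.\<close>

lemma case_sum_over_moves:
  fixes z :: "nat \<Rightarrow> real"
  assumes inj: "inj_on g {1..k + 1}" and const: "\<And>i. k < i \<Longrightarrow> g i = g (k + 1)" and kn: "k < n"
  shows "(if \<exists>i\<in>{1..k}. y = g i then z (THE i. i \<in> {1..k} \<and> y = g i)
      else if y = g (k + 1) then (\<Sum>m = k + 1..n. z m) else 0) = sum z {i \<in> {1..n}. g i = y}"
proof (cases "\<exists>i\<in>{1..k}. y = g i")
  case True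
  then obtain i where i: "i \<in> {1..k}" "y = g i" by blast
  have uniq: "j = i" if "g j = y" "1 \<le> j" for j
  proof (cases "j \<le> k + 1")
    case True
    then show ?thesis using that i inj_onD[OF inj, of j i] by auto
  next
    case False
    \<comment> \<open>An index beyond \<open>k + 1\<close> acts like \<open>k + 1\<close>, whose
      image differs from that of \<open>i\<close> by injectivity.\<close>
    then show ?thesis using that i inj_onD[OF inj, of "k + 1" i] const[of j] by auto
  qed
  have "(THE i. i \<in> {1..k} \<and> y = g i) = i"
  proof (rule the_equality)
    show "i \<in> {1..k} \<and> y = g i" using i by simp
    show "j = i" if "j \<in> {1..k} \<and> y = g j" for j using uniq[of j] that by simp
  qed
  moreover have "{i \<in> {1..n}. g i = y} = {i}"
  proof (intro equalityI subsetI)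
    show "j \<in> {i}" if "j \<in> {i \<in> {1..n}. g i = y}" for j using uniq[of j] that by simp
  qed (use i kn in auto)
  ultimately show ?thesis using True by simp
next
  case False
  have only: "k < i \<and> y = g (k + 1)" if "i \<in> {1..n}" "g i = y" for i
    using False that const[of i] by (cases "i \<le> k") auto
  have "{i \<in> {1..n}. g i = y} = (if y = g (k + 1) then {k + 1..n} else {})"
  proof (cases "y = g (k + 1)")
    case True
    have "i \<in> {i \<in> {1..n}. g i = y} \<longleftrightarrow> i \<in> {k + 1..n}" for i
      using only[of i] const[of i] True by (cases "k < i") auto
    then have "{i \<in> {1..n}. g i = y} = {k + 1..n}" by blast
    then show ?thesis by (simp only: True if_True refl)
  next
    case False
    then have "{i \<in> {1..n}. g i = y} = {}" using only by blast
    then show ?thesis by (simp only: False if_False)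
  qed
  then show ?thesis by (simp only: False if_False) simp
qed

subsection \<open>The annihilation model\<close>

text \<open>The rank is strictly decreasing, hence injective into \<open>{1..card F}\<close>, and
  the cardinalities match. It serves for occurrences of \<open>Circ\<close> as well as for block
  maxima.\<close>

lemma bij_betw_rank_from_top:
  fixes F :: "'a :: linorder set"
  assumes F: "finite F"
  shows "bij_betw (\<lambda>x. card {y \<in> F. x \<le> y}) F {1..card F}"
proof -
  let ?r = "\<lambda>x. card {y \<in> F. x \<le> y}"
  have less: "?r y < ?r x" if "x \<in> F" "x < y" for x y
  proof (rule psubset_card_mono)
    show "{v \<in> F. y \<le> v} \<subset> {v \<in> F. x \<le> v}"
    proof (rule psubsetI)
      have "x \<in> {v \<in> F. x \<le> v}" "x \<notin> {v \<in> F. y \<le> v}" using that by auto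
      then show "{v \<in> F. y \<le> v} \<noteq> {v \<in> F. x \<le> v}" by metis
    qed (use that in auto)
  qed (use F in simp)
  have inj: "inj_on ?r F"
  proof (rule linorder_inj_onI)
    show "?r x \<noteq> ?r y" if "x < y" "x \<in> F" "y \<in> F" for x y
      using less[OF that(2,1)] by linarith
  qed auto
  have "1 \<le> ?r x" if "x \<in> F" for x
    using F that by (simp add: Suc_le_eq card_gt_0_iff) blast
  moreover have "?r x \<le> card F" for x
    using F by (intro card_mono) auto
  ultimately have "?r ` F \<subseteq> {1..card F}" by auto
  then have "?r ` F = {1..card F}"
    using inj by (intro card_subset_eq) (auto simp: card_image)
  with inj show ?thesis by (simp add: bij_betw_def)
qed

lemma length_S_op [simp]: "length (S_op i A) = length A"
  by (simp add: S_op_def)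

lemma nth_S_op:
  "p < length A \<Longrightarrow> S_op i A ! p =
    (if A ! p = Circ \<and> card {q. p \<le> q \<and> q < length A \<and> A ! q = Circ} = i then Bullet else A ! p)"
  by (simp add: S_op_def)

lemma count_list_eq_card: "count_list A c = card {q. q < length A \<and> A ! q = c}"
  by (simp add: count_list_eq_length_filter length_filter_conv_card eq_commute)

lemma S_op_eq_id:
  assumes "count_list A Circ < i"
  shows "S_op i A = A"
proof (rule nth_equalityI)
  fix p assume p: "p < length (S_op i A)"
  have "card {q. p \<le> q \<and> q < length A \<and> A ! q = Circ} \<le> count_list A Circ"
    unfolding count_list_eq_card by (intro card_mono) auto
  then show "S_op i A ! p = A ! p" using p assms by (simp add: nth_S_op)
qed simp

text \<open>For \<open>i < j\<close> the index \<open>i\<close> numbers an actual occurrence, which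
  \<open>S_op i\<close> changes and \<open>S_op j\<close> keeps. The index one beyond the count
  stands for the identity.\<close>

lemma inj_on_S_op: "inj_on (\<lambda>i. S_op i A) {1..count_list A Circ + 1}"
proof (rule linorder_inj_onI)
  fix i j assume ij: "i < j" "i \<in> {1..count_list A Circ + 1}" "j \<in> {1..count_list A Circ + 1}"
  define F where "F = {q. q < length A \<and> A ! q = Circ}"
  have "finite F" by (simp add: F_def)
  from bij_betw_rank_from_top[OF this]
  have "(\<lambda>x. card {y \<in> F. x \<le> y}) ` F = {1..count_list A Circ}"
    by (simp add: bij_betw_def count_list_eq_card F_def)
  moreover have "i \<in> {1..count_list A Circ}" using ij by auto
  ultimately obtain p where p: "p \<in> F" "card {y \<in> F. p \<le> y} = i" by (metis (lifting) imageE)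
  have "{y \<in> F. p \<le> y} = {q. p \<le> q \<and> q < length A \<and> A ! q = Circ}" by (auto simp: F_def)
  then have "S_op i A ! p \<noteq> S_op j A ! p"
    using p ij by (simp add: nth_S_op F_def)
  then show "S_op i A \<noteq> S_op j A" by metis
qed auto

text \<open>The letter is appended before \<open>tl\<close> is taken, so that the empty word stays
  empty when \<open>h = 0\<close>; on nonempty words this is the shift of the model.\<close>

definition word_move :: "nat \<Rightarrow> site list \<Rightarrow> site list" where
  "word_move i A = S_op i (tl (A @ [Circ]))"

lemma length_word_move [simp]: "length (word_move i A) = length A"
  by (simp add: word_move_def)

lemma annihilation_prob_eq_sum:
  assumes "A \<in> St h" "B \<in> St h" and z_sum: "(\<Sum>i = 1..h + 1. z i) = 1"
  shows "annihilation_prob h z A B = sum z {i \<in> {1..h + 1}. word_move i A = B}"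
proof (cases "h = 0")
  case True
  then have "A = []" "B = []" using assms by (auto simp: St_def)
  \<comment> \<open>Every move fixes the empty word, so the sum is the total mass 1, as in the
    separate case of the definition.\<close>
  then have "{i \<in> {1..h + 1}. word_move i A = B} = {1..h + 1}"
    by (auto simp: word_move_def S_op_def)
  then show ?thesis using True \<open>A = []\<close> \<open>B = []\<close> z_sum by (simp add: annihilation_prob_def)
next
  case False
  define C where "C = tl A @ [Circ]"
  define k where "k = count_list C Circ"
  have C: "tl (A @ [Circ]) = C" "length C = h"
    using assms(1) False by (cases A; auto simp: C_def St_def)+
  have id: "S_op i C = C" if "k < i" for i
    using S_op_eq_id that by (simp add: k_def)
  have "k < h + 1" using count_le_length[of C Circ] C by (simp add: k_def)
  then have "(if \<exists>i\<in>{1..k}. B = S_op i C then z (THE i. i \<in> {1..k} \<and> B = S_op i C)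
      else if B = S_op (k + 1) C then (\<Sum>m = k + 1..h + 1. z m) else 0)
      = sum z {i \<in> {1..h + 1}. S_op i C = B}"
    using inj_on_S_op[of C] id by (intro case_sum_over_moves) (simp_all add: k_def)
  also have "S_op (k + 1) C = C" by (rule id) simp
  finally show ?thesis
    using False unfolding annihilation_prob_def word_move_def C(1)
    by (simp only: Let_def k_def C_def if_False)
qed

text \<open>Agreement of the last \<open>t\<close> letters: void for \<open>t = 0\<close>, and
  equality of words of length \<open>h\<close> for \<open>t = h\<close>.\<close>

definition agree_suffix :: "nat \<Rightarrow> nat \<Rightarrow> site list \<Rightarrow> site list \<Rightarrow> bool" where
  "agree_suffix h t A B \<longleftrightarrow> (\<forall>p<h. h - t \<le> p \<longrightarrow> A ! p = B ! p)"

text \<open>The shift moves the common part one place to the left and appends the same letter.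
  Occurrences of \<open>Circ\<close> are numbered from the right, so whether the letter at
  \<open>p\<close> changes depends only on the letters from \<open>p\<close> on.\<close>

lemma agree_suffix_word_move:
  assumes "length A = h" "length B = h" "t < h" "agree_suffix h t A B"
  shows "agree_suffix h (Suc t) (word_move i A) (word_move i B)"
proof -
  define C where "C = tl (A @ [Circ])"
  define D where "D = tl (B @ [Circ])"
  have len: "length C = h" "length D = h" using assms by (simp_all add: C_def D_def)
  have CD: "C ! q = D ! q" if "q < h" "h - Suc t \<le> q" for q
  proof (cases "Suc q < h")
    case True
    then show ?thesis
      using that assms by (auto simp: C_def D_def nth_tl nth_append agree_suffix_def)
  next
    case False
    then show ?thesis using that assms by (auto simp: C_def D_def nth_tl nth_append)
  qed
  show ?thesis
    unfolding agree_suffix_def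
  proof (intro allI impI)
    fix p assume p: "p < h" "h - Suc t \<le> p"
    have "{q. p \<le> q \<and> q < h \<and> C ! q = Circ} = {q. p \<le> q \<and> q < h \<and> D ! q = Circ}"
      using CD p by auto
    then show "word_move i A ! p = word_move i B ! p"
      using CD[OF p] p len by (simp add: word_move_def C_def[symmetric] D_def[symmetric] nth_S_op)
  qed
qed

lemma card_St: "card (St h) = 2 ^ h" and finite_St: "finite (St h)"
proof -
  have U: "(UNIV :: site set) = {Bullet, Circ}" using site.exhaust by auto
  then have f: "finite (UNIV :: site set)" and c: "card (UNIV :: site set) = 2" by (simp_all add: U)
  have St: "St h = {xs. set xs \<subseteq> UNIV \<and> length xs = h}" by (simp add: St_def)
  show "card (St h) = 2 ^ h" unfolding St card_lists_length_eq[OF f] c ..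
  show "finite (St h)" unfolding St by (rule finite_lists_length_eq[OF f])
qed

lemma equal_rows_annihilation:
  assumes "bij_betw e {..<card (St h)} (St h)"
    and "\<And>i. i \<in> {1..h + 1} \<Longrightarrow> 0 \<le> z i" "(\<Sum>i = 1..h + 1. z i) = 1"
  shows "equal_rows_power (card (St h)) h (transition_mat (St h) e (annihilation_prob h z))"
proof (rule random_map_power_equal_rows[where f = word_move and R = "agree_suffix h"])
  show "St h \<noteq> {}" using card_St[of h] by force
  show "annihilation_prob h z A B = sum z {i \<in> {1..h + 1}. word_move i A = B}"
    if "A \<in> St h" "B \<in> St h" for A B
    using annihilation_prob_eq_sum that assms(3) .
  show "A = B" if "A \<in> St h" "B \<in> St h" "agree_suffix h h A B" for A B
    using that by (auto simp: St_def agree_suffix_def intro: nth_equalityI)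
qed (use assms finite_St[of h] in \<open>auto simp: St_def agree_suffix_def[of _ 0] intro: agree_suffix_word_move\<close>)

subsection \<open>The enriched annihilation model\<close>

text \<open>Partitions are handled through their equivalence relation, since its restriction to the
  large elements can be compared without tracking how blocks are cut.\<close>

definition same_block :: "'a set set \<Rightarrow> 'a \<Rightarrow> 'a \<Rightarrow> bool" where
  "same_block \<sigma> x y \<longleftrightarrow> (\<exists>B\<in>\<sigma>. x \<in> B \<and> y \<in> B)"

lemma same_block_commute: "same_block \<sigma> x y \<longleftrightarrow> same_block \<sigma> y x"
  by (auto simp: same_block_def)

lemma partition_on_block_unique:
  assumes "partition_on A \<sigma>" "B \<in> \<sigma>" "C \<in> \<sigma>" "x \<in> B" "x \<in> C"
  shows "B = C"
  using disjointD[OF partition_onD2[OF assms(1)] assms(2,3)] assms(4,5) by blast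

lemma same_block_iff_mem:
  assumes "partition_on A \<sigma>" "B \<in> \<sigma>" "x \<in> B"
  shows "same_block \<sigma> x y \<longleftrightarrow> y \<in> B"
proof
  assume "same_block \<sigma> x y"
  then obtain C where C: "C \<in> \<sigma>" "x \<in> C" "y \<in> C" unfolding same_block_def by blast
  then show "y \<in> B" using partition_on_block_unique[OF assms(1) C(1) assms(2) C(2) assms(3)] by simp
next
  assume "y \<in> B"
  with assms(2,3) show "same_block \<sigma> x y" unfolding same_block_def by blast
qed

lemma partition_on_obtain_block:
  assumes "partition_on A \<sigma>" "x \<in> A"
  obtains B where "B \<in> \<sigma>" "x \<in> B"
  using assms by (auto simp: partition_on_def)

lemma same_block_self: "partition_on A \<sigma> \<Longrightarrow> x \<in> A \<Longrightarrow> same_block \<sigma> x x"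
  by (auto simp: partition_on_def same_block_def)

text \<open>A block is the class of any of its elements, so equal relations give equal
  classes.\<close>

lemma partition_on_subset_by_same_block:
  assumes \<sigma>: "partition_on A \<sigma>" and \<tau>: "partition_on A \<tau>"
    and eq: "\<And>x y. x \<in> A \<Longrightarrow> y \<in> A \<Longrightarrow> same_block \<sigma> x y \<longleftrightarrow> same_block \<tau> x y"
  shows "\<sigma> \<subseteq> \<tau>"
proof
  fix B assume B: "B \<in> \<sigma>"
  then have "B \<noteq> {}" "B \<subseteq> A" using \<sigma> by (auto simp: partition_on_def)
  then obtain x where x: "x \<in> B" "x \<in> A" by auto
  obtain C where C: "C \<in> \<tau>" "x \<in> C" using partition_on_obtain_block[OF \<tau> x(2)] .
  have "C \<subseteq> A" using \<tau> C by (auto simp: partition_on_def)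
  have "y \<in> B \<longleftrightarrow> y \<in> C" if "y \<in> A" for y
    using same_block_iff_mem[OF \<sigma> B x(1)] same_block_iff_mem[OF \<tau> C] eq[OF x(2) that] by simp
  then have "B = C" using \<open>B \<subseteq> A\<close> \<open>C \<subseteq> A\<close> by blast
  then show "B \<in> \<tau>" using C by simp
qed

lemma partition_on_eqI_same_block:
  assumes "partition_on A \<sigma>" "partition_on A \<tau>"
    and "\<And>x y. x \<in> A \<Longrightarrow> y \<in> A \<Longrightarrow> same_block \<sigma> x y \<longleftrightarrow> same_block \<tau> x y"
  shows "\<sigma> = \<tau>"
proof
  show "\<sigma> \<subseteq> \<tau>" using assms by (rule partition_on_subset_by_same_block)
  show "\<tau> \<subseteq> \<sigma>" by (rule partition_on_subset_by_same_block[OF assms(2,1) assms(3)[symmetric]])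
qed

section \<open>Removing the smallest element of a partition\<close>

lemma mem_down_iff:
  assumes "partition_on {1..h + 1} \<sigma>"
  shows "C \<in> down \<sigma> \<longleftrightarrow> C \<noteq> {} \<and> (\<exists>B\<in>\<sigma>. C = {x. 1 \<le> x \<and> x + 1 \<in> B})"
proof -
  \<comment> \<open>Elements of blocks are at least 1, so on \<open>B - {1}\<close> the truncated
    subtraction is a genuine shift and the image becomes a preimage.\<close>
  have "(\<lambda>x. x - 1) ` (B - {1}) = {x. 1 \<le> x \<and> x + 1 \<in> B}" if "B \<in> \<sigma>" for B
  proof -
    have "x \<ge> 1" if "x \<in> B" for x
      using assms \<open>B \<in> \<sigma>\<close> that by (force simp: partition_on_def)
    then show ?thesis by (force simp: image_iff)
  qed
  then show ?thesis by (auto simp: down_def)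
qed

lemma partition_on_down:
  assumes \<sigma>: "partition_on {1..h + 1} \<sigma>"
  shows "partition_on {1..h} (down \<sigma>)"
proof (rule partition_onI)
  show "\<Union> (down \<sigma>) = {1..h}"
  proof (intro equalityI subsetI)
    fix x assume "x \<in> \<Union> (down \<sigma>)"
    then obtain B where "B \<in> \<sigma>" "1 \<le> x" "x + 1 \<in> B"
      by (auto simp: mem_down_iff[OF \<sigma>])
    moreover then have "x + 1 \<in> {1..h + 1}" using \<sigma> unfolding partition_on_def by blast
    ultimately show "x \<in> {1..h}" by simp
  next
    fix x assume x: "x \<in> {1..h}"
    then obtain B where "B \<in> \<sigma>" "x + 1 \<in> B"
      using partition_on_obtain_block[OF \<sigma>, of "x + 1"] by auto
    then show "x \<in> \<Union> (down \<sigma>)"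
      using x by (intro UnionI[of "{y. 1 \<le> y \<and> y + 1 \<in> B}"]) (auto simp: mem_down_iff[OF \<sigma>])
  qed
  show "disjnt C D" if CD: "C \<in> down \<sigma>" "D \<in> down \<sigma>" "C \<noteq> D" for C D
  proof -
    obtain B B' where B: "B \<in> \<sigma>" "C = {x. 1 \<le> x \<and> x + 1 \<in> B}"
      and B': "B' \<in> \<sigma>" "D = {x. 1 \<le> x \<and> x + 1 \<in> B'}"
      using CD by (auto simp: mem_down_iff[OF \<sigma>])
    then have "B \<noteq> B'" using CD by blast
    then have "B \<inter> B' = {}" using partition_on_block_unique[OF \<sigma> B(1) B'(1)] by blast
    then show ?thesis using B B' by (auto simp: disjnt_def)
  qed
  show "{} \<notin> down \<sigma>" by (simp add: mem_down_iff[OF \<sigma>])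
qed

lemma same_block_down:
  assumes "partition_on {1..h + 1} \<sigma>" "1 \<le> x" "1 \<le> y"
  shows "same_block (down \<sigma>) x y \<longleftrightarrow> same_block \<sigma> (x + 1) (y + 1)"
proof
  assume "same_block (down \<sigma>) x y"
  then show "same_block \<sigma> (x + 1) (y + 1)"
    unfolding same_block_def by (auto simp: mem_down_iff[OF assms(1)])
next
  assume "same_block \<sigma> (x + 1) (y + 1)"
  then obtain B where B: "B \<in> \<sigma>" "x + 1 \<in> B" "y + 1 \<in> B" by (auto simp: same_block_def)
  then have "{v. 1 \<le> v \<and> v + 1 \<in> B} \<in> down \<sigma>"
    using assms by (auto simp: mem_down_iff[OF assms(1)])
  then show "same_block (down \<sigma>) x y"
    unfolding same_block_def by (rule bexI[rotated]) (use B assms in simp)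
qed

text \<open>Number of the block of \<open>x\<close> in the order of decreasing maxima, written in terms of
  the restriction of \<open>same_block \<rho>\<close> to \<open>{x..n}\<close> only: it counts the block maxima \<open>M\<close> that are
  at least the maximum of the block of \<open>x\<close>.\<close>

definition block_rank :: "nat \<Rightarrow> nat set set \<Rightarrow> nat \<Rightarrow> nat" where
  "block_rank n \<rho> x = card {M \<in> {x..n}. (\<forall>y\<in>{M<..n}. \<not> same_block \<rho> M y) \<and>
     (\<forall>y\<in>{x..n}. same_block \<rho> x y \<longrightarrow> y \<le> M)}"

text \<open>The locality behind the coupling: all arguments of \<open>same_block\<close> in the
  definition lie in \<open>{x..n}\<close>.\<close>

lemma block_rank_cong:
  assumes "\<And>u v. u \<in> {x..n} \<Longrightarrow> v \<in> {x..n} \<Longrightarrow> same_block \<rho> u v \<longleftrightarrow> same_block \<rho>' u v"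
  shows "block_rank n \<rho> x = block_rank n \<rho>' x"
  unfolding block_rank_def using assms
  by (intro arg_cong[where f = card] Collect_cong) auto

section \<open>Numbering of blocks by decreasing maxima, and insertion of a new largest
  element\<close>

context
  fixes n :: nat and \<rho> :: "nat set set"
  assumes \<rho>: "partition_on {1..n} \<rho>"
begin

lemma block_subset: "B \<in> \<rho> \<Longrightarrow> B \<subseteq> {1..n}"
  using \<rho> by (auto simp: partition_on_def)

lemma block_finite: "B \<in> \<rho> \<Longrightarrow> finite B"
  using block_subset finite_subset by blast

lemma block_nonempty: "B \<in> \<rho> \<Longrightarrow> B \<noteq> {}"
  using \<rho> by (auto simp: partition_on_def)

lemma Max_in_block: "B \<in> \<rho> \<Longrightarrow> Max B \<in> B"
  using block_finite block_nonempty by simp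

lemma finite_blocks: "finite \<rho>"
  using finite_elements[OF _ \<rho>] by simp

lemma inj_on_Max: "inj_on Max \<rho>"
proof (rule inj_onI)
  show "B = C" if "B \<in> \<rho>" "C \<in> \<rho>" "Max B = Max C" for B C
    using partition_on_block_unique[OF \<rho> that(1,2) Max_in_block[OF that(1)]]
      Max_in_block[OF that(2)] that(3) by simp
qed

text \<open>The first condition in \<open>block_rank\<close> makes \<open>M\<close> the maximum of
  its own block, the second makes it at least \<open>Max B\<close>; then \<open>M \<ge> x\<close> as
  well. Distinct blocks have distinct maxima, so counting maxima counts blocks.\<close>

lemma block_rank_eq_card:
  assumes B: "B \<in> \<rho>" and x: "x \<in> B"
  shows "block_rank n \<rho> x = card {C \<in> \<rho>. Max B \<le> Max C}"
proof -
  have "{M \<in> {x..n}. (\<forall>y\<in>{M<..n}. \<not> same_block \<rho> M y) \<and>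
     (\<forall>y\<in>{x..n}. same_block \<rho> x y \<longrightarrow> y \<le> M)} = Max ` {C \<in> \<rho>. Max B \<le> Max C}"
    (is "?L = ?R")
  proof (intro equalityI subsetI)
    fix M assume M: "M \<in> ?L"
    then have "M \<in> {1..n}" using x block_subset[OF B] by force
    then obtain C where C: "C \<in> \<rho>" "M \<in> C" using partition_on_obtain_block[OF \<rho>] by blast
    have "y \<le> M" if "y \<in> C" for y
      using M same_block_iff_mem[OF \<rho> C, of y] that block_subset[OF C(1)] by force
    then have "Max C = M" using C block_finite by (intro Max_eqI) auto
    moreover have "Max B \<le> M"
      using M same_block_iff_mem[OF \<rho> B x, of "Max B"] Max_in_block[OF B] block_subset[OF B]
        Max_ge[OF block_finite[OF B] x] by force
    ultimately show "M \<in> ?R" using C by auto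
  next
    fix M assume "M \<in> ?R"
    then obtain C where C: "C \<in> \<rho>" "M = Max C" "Max B \<le> M" by auto
    have MC: "M \<in> C" using C Max_in_block by simp
    have "x \<le> M" using Max_ge[OF block_finite[OF B] x] C by simp
    moreover have "M \<le> n" using MC block_subset[OF C(1)] by auto
    moreover have "\<not> same_block \<rho> M y" if "y \<in> {M<..n}" for y
      using same_block_iff_mem[OF \<rho> C(1) MC, of y] Max_ge[OF block_finite[OF C(1)], of y] C(2) that
      by auto
    moreover have "y \<le> M" if "same_block \<rho> x y" for y
      using same_block_iff_mem[OF \<rho> B x, of y] Max_ge[OF block_finite[OF B], of y] C(3) that
      by auto
    ultimately show "M \<in> ?L" by auto
  qed
  then show ?thesis
    unfolding block_rank_def
    using card_image[OF inj_on_subset[OF inj_on_Max]] by (metis (no_types, lifting) mem_Collect_eq subsetI)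
qed

lemma bij_betw_block_rank: "bij_betw (\<lambda>B. card {C \<in> \<rho>. Max B \<le> Max C}) \<rho> {1..card \<rho>}"
proof -
  have "bij_betw (\<lambda>x. card {y \<in> Max ` \<rho>. x \<le> y}) (Max ` \<rho>) {1..card \<rho>}"
    using bij_betw_rank_from_top[of "Max ` \<rho>"] finite_blocks card_image[OF inj_on_Max] by simp
  moreover have "bij_betw Max \<rho> (Max ` \<rho>)" using inj_on_Max by (rule inj_on_imp_bij_betw)
  ultimately have "bij_betw ((\<lambda>x. card {y \<in> Max ` \<rho>. x \<le> y}) \<circ> Max) \<rho> {1..card \<rho>}"
    by (rule bij_betw_trans[rotated])
  moreover have "card {y \<in> Max ` \<rho>. Max B \<le> y} = card {C \<in> \<rho>. Max B \<le> Max C}" for B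
  proof -
    have "{y \<in> Max ` \<rho>. Max B \<le> y} = Max ` {C \<in> \<rho>. Max B \<le> Max C}" by auto
    then show ?thesis
      using card_image[OF inj_on_subset[OF inj_on_Max, of "{C \<in> \<rho>. Max B \<le> Max C}"]] by auto
  qed
  ultimately show ?thesis by (simp add: comp_def)
qed

text \<open>The ranks biject the blocks with \<open>{1..card \<rho>}\<close>, so the description by
  \<open>THE\<close> is well defined.\<close>

lemma ith_block:
  assumes "i \<in> {1..card \<rho>}"
  shows "ith_block i \<rho> \<in> \<rho>" "B \<in> \<rho> \<Longrightarrow> card {C \<in> \<rho>. Max B \<le> Max C} = i \<longleftrightarrow> B = ith_block i \<rho>"
proof -
  let ?r = "\<lambda>B. card {C \<in> \<rho>. Max B \<le> Max C}"
  have inj: "inj_on ?r \<rho>" and img: "?r ` \<rho> = {1..card \<rho>}"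
    using bij_betw_block_rank by (simp_all add: bij_betw_def)
  obtain D where D: "D \<in> \<rho>" "?r D = i" using assms unfolding img[symmetric] by auto
  have eq: "ith_block i \<rho> = D"
    unfolding ith_block_def
  proof (rule the_equality)
    show "B = D" if "B \<in> \<rho> \<and> ?r B = i" for B
      using that D inj_onD[OF inj, of B D] by simp
  qed (use D in simp)
  show "ith_block i \<rho> \<in> \<rho>" using eq D by simp
  show "?r B = i \<longleftrightarrow> B = ith_block i \<rho>" if "B \<in> \<rho>"
    using eq D inj_onD[OF inj, of B D] that by auto
qed

lemma block_rank_range:
  assumes "x \<in> {1..n}"
  shows "block_rank n \<rho> x \<in> {1..card \<rho>}"
proof -
  obtain B where "B \<in> \<rho>" "x \<in> B" using partition_on_obtain_block[OF \<rho> assms] .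
  then show ?thesis
    using bij_betwE[OF bij_betw_block_rank] block_rank_eq_card[of B x] by simp
qed

lemma mem_ith_block_iff:
  assumes "i \<in> {1..card \<rho>}" "x \<in> {1..n}"
  shows "x \<in> ith_block i \<rho> \<longleftrightarrow> block_rank n \<rho> x = i"
proof -
  obtain B where B: "B \<in> \<rho>" "x \<in> B" using partition_on_obtain_block[OF \<rho> assms(2)] .
  have "x \<in> ith_block i \<rho> \<longleftrightarrow> B = ith_block i \<rho>"
    using B partition_on_block_unique[OF \<rho> B(1) ith_block(1)[OF assms(1)]] by auto
  also have "\<dots> \<longleftrightarrow> block_rank n \<rho> x = i"
    using ith_block(2)[OF assms(1) B(1)] block_rank_eq_card[OF B] by simp
  finally show ?thesis .
qed

lemma partition_on_J_op: "partition_on {1..n + 1} (J_op n i \<rho>)"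
proof (cases "i \<in> {1..card \<rho>}")
  case True
  let ?D = "ith_block i \<rho>"
  have D: "?D \<in> \<rho>" by (rule ith_block[OF True])
  have J: "J_op n i \<rho> = insert (insert (n + 1) ?D) (\<rho> - {?D})"
    using True by (simp add: J_op_def)
  have U: "\<Union> \<rho> = {1..n}" using \<rho> by (simp add: partition_on_def)
  have new: "n + 1 \<notin> B" if "B \<in> \<rho>" for B using block_subset[OF that] by auto
  show ?thesis
  proof (rule partition_onI)
    have "\<Union> (J_op n i \<rho>) = insert (n + 1) (\<Union> \<rho>)" unfolding J using D by blast
    then show "\<Union> (J_op n i \<rho>) = {1..n + 1}" unfolding U by auto
    show "{} \<notin> J_op n i \<rho>"
      using block_nonempty unfolding J by auto
    have dis: "B \<inter> C = {}" if "B \<in> \<rho>" "C \<in> \<rho>" "B \<noteq> C" for B C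
      using partition_on_block_unique[OF \<rho> that(1,2)] that(3) by (metis disjoint_iff)
    show "disjnt B C" if "B \<in> J_op n i \<rho>" "C \<in> J_op n i \<rho>" "B \<noteq> C" for B C
      using that dis[OF D] dis[of B C] new unfolding J disjnt_def by auto
  qed
next
  case False
  then have J: "J_op n i \<rho> = insert {n + 1} \<rho>" by (auto simp: J_op_def)
  have "disjnt {n + 1} (\<Union> \<rho>)" using \<rho> by (simp add: partition_on_def)
  moreover have "{1..n + 1} - {n + 1} = {1..n}" by auto
  ultimately show ?thesis using \<rho> unfolding J by (subst partition_on_insert) auto
qed

lemma same_block_J_op_old:
  assumes "x \<in> {1..n}" "y \<in> {1..n}"
  shows "same_block (J_op n i \<rho>) x y \<longleftrightarrow> same_block \<rho> x y"
proof (cases "i \<in> {1..card \<rho>}")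
  case True
  have "ith_block i \<rho> \<in> \<rho>" by (rule ith_block[OF True])
  moreover have "J_op n i \<rho> = insert (insert (n + 1) (ith_block i \<rho>)) (\<rho> - {ith_block i \<rho>})"
    using True by (simp add: J_op_def)
  ultimately show ?thesis using assms unfolding same_block_def by auto
next
  case False
  then have "J_op n i \<rho> = \<rho> \<union> {{n + 1}}" by (auto simp: J_op_def)
  then show ?thesis using assms unfolding same_block_def by auto
qed

text \<open>The equivalence also covers \<open>i\<close> beyond the number of blocks: then
  \<open>n + 1\<close> is alone and no element has rank \<open>i\<close>. Thus one criterion, local
  by \<open>block_rank_cong\<close>, serves for all moves.\<close>

lemma same_block_J_op_new:
  assumes "1 \<le> i" "x \<in> {1..n}"
  shows "same_block (J_op n i \<rho>) (n + 1) x \<longleftrightarrow> block_rank n \<rho> x = i"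
proof (cases "i \<in> {1..card \<rho>}")
  case True
  have "J_op n i \<rho> = insert (insert (n + 1) (ith_block i \<rho>)) (\<rho> - {ith_block i \<rho>})"
    using True by (simp add: J_op_def)
  moreover have "n + 1 \<notin> B" if "B \<in> \<rho>" for B using block_subset[OF that] by auto
  ultimately have "same_block (J_op n i \<rho>) (n + 1) x \<longleftrightarrow> x \<in> ith_block i \<rho>"
    using assms unfolding same_block_def by auto
  then show ?thesis using mem_ith_block_iff[OF True assms(2)] by simp
next
  case False
  then have J: "J_op n i \<rho> = \<rho> \<union> {{n + 1}}" by (auto simp: J_op_def)
  have "n + 1 \<notin> B" if "B \<in> \<rho>" for B using block_subset[OF that] by auto
  then have "\<not> same_block (J_op n i \<rho>) (n + 1) x"
    using assms unfolding same_block_def J by auto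
  then show ?thesis using False assms block_rank_range[OF assms(2)] by auto
qed

text \<open>The smaller index numbers an actual block, and its elements are joined to
  \<open>n + 1\<close> under that index only.\<close>

lemma inj_on_J_op: "inj_on (\<lambda>i. J_op n i \<rho>) {1..card \<rho> + 1}"
proof (rule linorder_inj_onI)
  fix i j assume ij: "i < j" "i \<in> {1..card \<rho> + 1}" "j \<in> {1..card \<rho> + 1}"
  then have i: "i \<in> {1..card \<rho>}" by auto
  obtain x where x: "x \<in> ith_block i \<rho>" using block_nonempty[OF ith_block(1)[OF i]] by auto
  then have xn: "x \<in> {1..n}" using block_subset[OF ith_block(1)[OF i]] by auto
  then have "block_rank n \<rho> x = i" using mem_ith_block_iff[OF i] x by simp
  then have "same_block (J_op n i \<rho>) (n + 1) x" "\<not> same_block (J_op n j \<rho>) (n + 1) x"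
    using same_block_J_op_new[OF _ xn] ij by auto
  then show "J_op n i \<rho> \<noteq> J_op n j \<rho>" by metis
qed auto

lemma card_blocks_le: "card \<rho> \<le> n"
proof -
  have "card \<rho> = card (Max ` \<rho>)" using card_image[OF inj_on_Max] by simp
  also have "\<dots> \<le> card {1..n}"
    using Max_in_block block_subset by (intro card_mono) blast+
  finally show ?thesis by simp
qed

end

section \<open>Coupling of the moves on partitions\<close>

definition partition_move :: "nat \<Rightarrow> nat \<Rightarrow> nat set set \<Rightarrow> nat set set" where
  "partition_move h i \<sigma> = J_op h i (down \<sigma>)"

lemma partition_on_partition_move:
  "partition_on {1..h + 1} \<sigma> \<Longrightarrow> partition_on {1..h + 1} (partition_move h i \<sigma>)"
  unfolding partition_move_def by (intro partition_on_J_op partition_on_down)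

lemma enriched_prob_eq_sum:
  assumes "partition_on {1..h + 1} \<sigma>"
  shows "enriched_prob h z \<sigma> \<tau> = sum z {i \<in> {1..h + 1}. partition_move h i \<sigma> = \<tau>}"
proof -
  define \<rho> where "\<rho> = down \<sigma>"
  define k where "k = card \<rho>"
  have \<rho>: "partition_on {1..h} \<rho>" unfolding \<rho>_def by (rule partition_on_down[OF assms])
  have J: "J_op h i \<rho> = \<rho> \<union> {{h + 1}}" if "k < i" for i
    using that by (auto simp: J_op_def k_def)
  have "k < h + 1" using card_blocks_le[OF \<rho>] by (simp add: k_def)
  then have "(if \<exists>i\<in>{1..k}. \<tau> = J_op h i \<rho> then z (THE i. i \<in> {1..k} \<and> \<tau> = J_op h i \<rho>)
      else if \<tau> = J_op h (k + 1) \<rho> then (\<Sum>m = k + 1..h + 1. z m) else 0)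
      = sum z {i \<in> {1..h + 1}. J_op h i \<rho> = \<tau>}"
    using inj_on_J_op[OF \<rho>] J by (intro case_sum_over_moves) (simp_all add: k_def)
  \<comment> \<open>The index one beyond the blocks creates a singleton, as in the second case of
    the definition.\<close>
  also have "J_op h (k + 1) \<rho> = \<rho> \<union> {{h + 1}}" by (rule J) simp
  finally show ?thesis
    unfolding enriched_prob_def partition_move_def by (simp only: Let_def k_def \<rho>_def)
qed

text \<open>The interval has \<open>t + 1\<close> elements: only \<open>h + 1\<close> for
  \<open>t = 0\<close>, and all of \<open>{1..h + 1}\<close> for \<open>t = h\<close>. Hence
  \<open>h\<close> moves suffice for \<open>h + 1\<close> points.\<close>

definition agree_top :: "nat \<Rightarrow> nat \<Rightarrow> nat set set \<Rightarrow> nat set set \<Rightarrow> bool" where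
  "agree_top h t \<sigma> \<tau> \<longleftrightarrow>
     (\<forall>x\<in>{h + 1 - t..h + 1}. \<forall>y\<in>{h + 1 - t..h + 1}. same_block \<sigma> x y \<longleftrightarrow> same_block \<tau> x y)"

text \<open>After the shift the agreement lives on \<open>{h - t..h}\<close>, and insertion
  preserves it there. The new element joins \<open>x\<close> exactly when \<open>block_rank\<close>
  of \<open>x\<close> is \<open>i\<close>, which is the same for both partitions because that rank
  sees only elements from \<open>x\<close> on.\<close>

lemma agree_top_partition_move:
  assumes \<sigma>: "partition_on {1..h + 1} \<sigma>" and \<tau>: "partition_on {1..h + 1} \<tau>"
    and t: "t < h" and agree: "agree_top h t \<sigma> \<tau>" and i: "1 \<le> i"
  shows "agree_top h (Suc t) (partition_move h i \<sigma>) (partition_move h i \<tau>)"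
proof -
  note \<sigma>' = partition_on_down[OF \<sigma>] and \<tau>' = partition_on_down[OF \<tau>]
  have down: "same_block (down \<sigma>) x y \<longleftrightarrow> same_block (down \<tau>) x y"
    if "x \<in> {h - t..h}" "y \<in> {h - t..h}" for x y
  proof -
    \<comment> \<open>The bound \<open>t < h\<close> keeps \<open>h - t\<close> at least 1.\<close>
    have "1 \<le> x" "1 \<le> y" "x + 1 \<in> {h + 1 - t..h + 1}" "y + 1 \<in> {h + 1 - t..h + 1}"
      using that t by auto
    then show ?thesis
      using agree same_block_down[OF \<sigma>] same_block_down[OF \<tau>] unfolding agree_top_def by metis
  qed
  have old: "same_block (partition_move h i \<sigma>) x y \<longleftrightarrow> same_block (partition_move h i \<tau>) x y"
    if "x \<in> {h - t..h}" "y \<in> {h - t..h}" for x y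
  proof -
    have "x \<in> {1..h}" "y \<in> {1..h}" using that t by auto
    then show ?thesis
      using down[OF that] same_block_J_op_old[OF \<sigma>'] same_block_J_op_old[OF \<tau>']
      unfolding partition_move_def by metis
  qed
  have new: "same_block (partition_move h i \<sigma>) (h + 1) x \<longleftrightarrow> same_block (partition_move h i \<tau>) (h + 1) x"
    if x: "x \<in> {h - t..h}" for x
  proof -
    have "x \<in> {1..h}" using x t by auto
    moreover have "block_rank h (down \<sigma>) x = block_rank h (down \<tau>) x"
      using x by (intro block_rank_cong down) auto
    ultimately show ?thesis
      using same_block_J_op_new[OF \<sigma>' i] same_block_J_op_new[OF \<tau>' i]
      unfolding partition_move_def by metis
  qed
  have self: "same_block (partition_move h i \<upsilon>) (h + 1) (h + 1)"
    if "partition_on {1..h + 1} \<upsilon>" for \<upsilon>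
    using same_block_self[OF partition_on_partition_move[OF that]] by simp
  show ?thesis
    unfolding agree_top_def
  proof (intro ballI)
    fix x y assume "x \<in> {h + 1 - Suc t..h + 1}" "y \<in> {h + 1 - Suc t..h + 1}"
    then have "x \<in> {h - t..h} \<or> x = h + 1" "y \<in> {h - t..h} \<or> y = h + 1" by auto
    then show "same_block (partition_move h i \<sigma>) x y \<longleftrightarrow> same_block (partition_move h i \<tau>) x y"
      using old new self[OF \<sigma>] self[OF \<tau>] same_block_commute by metis
  qed
qed

section \<open>Size of the state space and conclusion for both models\<close>

lemma finite_set_partitions: "finite (set_partitions n)"
  unfolding set_partitions_def by (rule finitely_many_partition_on) simp

text \<open>Translates the one-state case of \<open>spectrum_cP\<close> into \<open>h = 0\<close>:
  with a single state, the one-block partition and the partition into singletons coincide.\<close>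

lemma card_set_partitions_Suc: "card (set_partitions (h + 1)) = 1 \<longleftrightarrow> h = 0"
proof
  have one: "{{1..h + 1}} \<in> set_partitions (h + 1)"
    by (auto simp: set_partitions_def intro!: partition_on_space)
  have all: "(\<lambda>x. {x}) ` {1..h + 1} \<in> set_partitions (h + 1)"
    unfolding set_partitions_def by (intro CollectI partition_on_singletons)
  assume "card (set_partitions (h + 1)) = 1"
  then obtain \<upsilon> where "set_partitions (h + 1) = {\<upsilon>}" by (auto simp: card_1_singleton_iff)
  then have "(\<lambda>x. {x}) ` {1..h + 1} = {{1..h + 1}}" using one all by (metis singletonD)
  moreover have "{1} \<in> (\<lambda>x. {x}) ` {1..h + 1}" by (intro imageI) simp
  ultimately have "{1} = {1..h + 1}" by (metis singletonD)
  then have "h + 1 \<in> {1}" by simp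
  then show "h = 0" by simp
next
  assume "h = 0"
  have one: "partition_on {1::nat} {{1}}" by (rule partition_on_space) simp
  have "\<sigma> = {{1}}" if \<sigma>: "partition_on {1::nat} \<sigma>" for \<sigma>
  proof (rule partition_on_eqI_same_block[OF \<sigma> one])
    fix x y :: nat assume "x \<in> {1}" "y \<in> {1}"
    then show "same_block \<sigma> x y \<longleftrightarrow> same_block {{1}} x y"
      using same_block_self[OF \<sigma>, of 1] same_block_self[OF one, of 1] by simp
  qed
  moreover have "set_partitions (h + 1) = {\<sigma>. partition_on {1} \<sigma>}"
    using \<open>h = 0\<close> by (simp add: set_partitions_def)
  ultimately have "set_partitions (h + 1) = {{{1}}}" using one by blast
  then show "card (set_partitions (h + 1)) = 1" by simp
qed

lemma equal_rows_enriched: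
  assumes "bij_betw e {..<card (set_partitions (h + 1))} (set_partitions (h + 1))"
    and "\<And>i. i \<in> {1..h + 1} \<Longrightarrow> 0 \<le> z i" "(\<Sum>i = 1..h + 1. z i) = 1"
  shows "equal_rows_power (card (set_partitions (h + 1))) h
    (transition_mat (set_partitions (h + 1)) e (enriched_prob h z))"
proof (rule random_map_power_equal_rows[where f = "partition_move h" and R = "agree_top h"])
  have "{{1..h + 1}} \<in> set_partitions (h + 1)"
    by (auto simp: set_partitions_def intro!: partition_on_space)
  then show "set_partitions (h + 1) \<noteq> {}" by blast
  show "enriched_prob h z \<sigma> \<tau> = sum z {i \<in> {1..h + 1}. partition_move h i \<sigma> = \<tau>}"
    if "\<sigma> \<in> set_partitions (h + 1)" for \<sigma> \<tau>
    using that by (intro enriched_prob_eq_sum) (simp add: set_partitions_def)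
  show "partition_move h i \<sigma> \<in> set_partitions (h + 1)"
    if "\<sigma> \<in> set_partitions (h + 1)" for i \<sigma>
    using that partition_on_partition_move by (simp add: set_partitions_def)
  \<comment> \<open>The only pair to compare is \<open>h + 1\<close> with itself, so reflexivity
    decides.\<close>
  show "agree_top h 0 \<sigma> \<tau>"
    if "\<sigma> \<in> set_partitions (h + 1)" "\<tau> \<in> set_partitions (h + 1)" for \<sigma> \<tau>
    using that same_block_self[of "{1..h + 1}" _ "h + 1"]
    by (simp add: set_partitions_def agree_top_def)
  show "agree_top h (Suc t) (partition_move h i \<sigma>) (partition_move h i \<tau>)"
    if "t < h" "i \<in> {1..h + 1}" "\<sigma> \<in> set_partitions (h + 1)" "\<tau> \<in> set_partitions (h + 1)"
      "agree_top h t \<sigma> \<tau>" for t i \<sigma> \<tau>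
    using that by (intro agree_top_partition_move) (auto simp: set_partitions_def)
  show "\<sigma> = \<tau>"
    if "\<sigma> \<in> set_partitions (h + 1)" "\<tau> \<in> set_partitions (h + 1)" "agree_top h h \<sigma> \<tau>" for \<sigma> \<tau>
    using that by (intro partition_on_eqI_same_block[of "{1..h + 1}"])
      (auto simp: set_partitions_def agree_top_def)
qed (use assms finite_set_partitions in auto)

text \<open>Existence and uniqueness are part of the claim, as they justify speaking of the
  stationary distribution. For \<open>h = 0\<close> both chains have a single state, so 0 is not an
  eigenvalue; \<open>order 1\<close> is the algebraic multiplicity of 1.\<close>

theorem theorem4p19:
  fixes h H :: nat and z :: "nat \<Rightarrow> real"
    and e :: "nat \<Rightarrow> site list" and e' :: "nat \<Rightarrow> nat set set"
    and P P' :: "real mat"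
  assumes H: "H = h + 1"
    and z_nonneg: "\<And>i. i \<in> {1..h + 1} \<Longrightarrow> 0 \<le> z i"
    and z_sum: "(\<Sum>i = 1..h + 1. z i) = 1"
    and e: "bij_betw e {..<card (St h)} (St h)"
    and e': "bij_betw e' {..<card (set_partitions H)} (set_partitions H)"
    and P: "P = transition_mat (St h) e (annihilation_prob h z)"
    and P': "P' = transition_mat (set_partitions H) e' (enriched_prob h z)"
  shows "(\<exists>!\<pi>. stationary P \<pi>) \<and> (\<exists>!\<pi>'. stationary P' \<pi>')
    \<and> (\<forall>\<pi> \<eta>. stationary P \<pi> \<and> prob_vec (card (St h)) \<eta>
          \<longrightarrow> mat_of_row \<eta> * P ^\<^sub>m h = mat_of_row \<pi>)
    \<and> (\<forall>\<pi>' \<eta>'. stationary P' \<pi>' \<and> prob_vec (card (set_partitions H)) \<eta>'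
          \<longrightarrow> mat_of_row \<eta>' * P' ^\<^sub>m h = mat_of_row \<pi>')
    \<and> spectrum (map_mat complex_of_real P) = (if h = 0 then {1} else {0, 1})
    \<and> order 1 (char_poly (map_mat complex_of_real P)) = 1
    \<and> spectrum (map_mat complex_of_real P') = (if h = 0 then {1} else {0, 1})
    \<and> order 1 (char_poly (map_mat complex_of_real P')) = 1"
proof -
  interpret W: equal_rows_power "card (St h)" h P
    unfolding P by (rule equal_rows_annihilation[OF e z_nonneg z_sum])
  interpret E: equal_rows_power "card (set_partitions H)" h P'
    unfolding P' H by (rule equal_rows_enriched[OF e'[unfolded H] z_nonneg z_sum])
  have "card (St h) = 1 \<longleftrightarrow> h = 0" by (simp add: card_St)
  moreover have "card (set_partitions H) = 1 \<longleftrightarrow> h = 0"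
    unfolding H by (rule card_set_partitions_Suc)
  moreover have "\<exists>!\<pi>. stationary P \<pi>"
    using W.stationary_limit_row W.stationary_unique by (rule ex1I)
  moreover have "\<exists>!\<pi>'. stationary P' \<pi>'"
    using E.stationary_limit_row E.stationary_unique by (rule ex1I)
  moreover have "mat_of_row \<eta> * P ^\<^sub>m h = mat_of_row \<pi>"
    if "stationary P \<pi> \<and> prob_vec (card (St h)) \<eta>" for \<pi> \<eta>
    using that W.stationary_unique[of \<pi>] W.prob_vec_mult_pow[of \<eta>] by simp
  moreover have "mat_of_row \<eta>' * P' ^\<^sub>m h = mat_of_row \<pi>'"
    if "stationary P' \<pi>' \<and> prob_vec (card (set_partitions H)) \<eta>'" for \<pi>' \<eta>'
    using that E.stationary_unique[of \<pi>'] E.prob_vec_mult_pow[of \<eta>'] by simp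
  ultimately show ?thesis
    using W.spectrum_cP W.order_char_poly_cP E.spectrum_cP E.order_char_poly_cP by simp
qed

end
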